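(* Let $q$ be a prime power, $n\ge 1$, and $L_q^n$ the lattice of all subspaces of $\mathbb{F}_q^n$ ordered by inclusion and ranked by dimension. Then $\mathcal{M}(L_q^n,-1)=0$.
   Context: For a finite ranked poset $\mathcal{P}$, $\mathrm{rk}(\mathcal{P})$ is the maximum rank and $\rho(x,y,z)=3\,\mathrm{rk}(\mathcal{P})-\mathrm{rk}(x)-\mathrm{rk}(y)-\mathrm{rk}(z)$. Let $\delta_3(x,y,z)=1$ if $x=y=z$ and $0$ otherwise, and $J$ the unique integer-valued function on triples $x\le y\le z$ with $\sum_{x\le a\le y\le b\le z}J(a,y,b)=\delta_3(x,y,z)$ for all $x\le y\le z$. Then $\mathcal{M}(\mathcal{P},t)=\sum_{x\le y\le z}J(x,y,z)\,t^{\rho(x,y,z)}$. *)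

theory Defs
  imports "HOL-Analysis.Analysis"
begin

text \<open>A finite ranked poset is given by a carrier P, an order le on P and a rank function rk.\<close>

definition delta3 :: "'b \<Rightarrow> 'b \<Rightarrow> 'b \<Rightarrow> int" where
  "delta3 x y z = (if x = y \<and> y = z then 1 else 0)"

text \<open>The unique integer-valued function J on triples x \<le> y \<le> z of P with
  sum over x \<le> a \<le> y \<le> b \<le> z of J a y b = delta3 x y z.  Outside such triples
  J is normalised to 0 (irrelevant values).\<close>

definition Jfun :: "'b set \<Rightarrow> ('b \<Rightarrow> 'b \<Rightarrow> bool) \<Rightarrow> 'b \<Rightarrow> 'b \<Rightarrow> 'b \<Rightarrow> int" where
  "Jfun P le = (THE J.
     (\<forall>x\<in>P. \<forall>y\<in>P. \<forall>z\<in>P. le x y \<and> le y z \<longrightarrow>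
        (\<Sum>(a,b)\<in>{(a,b). a \<in> P \<and> b \<in> P \<and> le x a \<and> le a y \<and> le y b \<and> le b z}. J a y b)
          = delta3 x y z) \<and>
     (\<forall>x y z. \<not> (x \<in> P \<and> y \<in> P \<and> z \<in> P \<and> le x y \<and> le y z) \<longrightarrow> J x y z = 0))"

definition maxrank :: "'b set \<Rightarrow> ('b \<Rightarrow> nat) \<Rightarrow> nat" where
  "maxrank P rk = Max (rk ` P)"

definition rho :: "'b set \<Rightarrow> ('b \<Rightarrow> nat) \<Rightarrow> 'b \<Rightarrow> 'b \<Rightarrow> 'b \<Rightarrow> int" where
  "rho P rk x y z = 3 * int (maxrank P rk) - int (rk x) - int (rk y) - int (rk z)"

text \<open>The polynomial M(P,t), evaluated at t (rho is nonnegative on P).\<close>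
definition Mpoly :: "'b set \<Rightarrow> ('b \<Rightarrow> 'b \<Rightarrow> bool) \<Rightarrow> ('b \<Rightarrow> nat) \<Rightarrow> 'c::comm_ring_1 \<Rightarrow> 'c" where
  "Mpoly P le rk t =
     (\<Sum>(x,y,z)\<in>{(x,y,z). x \<in> P \<and> y \<in> P \<and> z \<in> P \<and> le x y \<and> le y z}.
        of_int (Jfun P le x y z) * t ^ nat (rho P rk x y z))"

text \<open>Subspace lattice of F^n, F a finite field, n = CARD('n).\<close>
definition subspace_lattice :: "('a::{field,finite} ^ 'n) set set" where
  "subspace_lattice = {S. vec.subspace S}"

end

theory Submission
  imports Defs
begin

(* Write s(x) = (-1)^rk(x) and D for the diagonal of signs in the incidence algebra. Then
   J(x,y,z) = mu(x,y) mu(y,z), so up to the sign (-1)^(3 rk P) the value M(P,-1) is the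
   (bottom, top) entry of zeta (D mu D) (mu D) zeta. If every interval [u,w] whose end points
   have ranks of different parity has signed sum zero, then zeta commutes with D zeta D, hence
   with its inverse D mu D, and the product collapses to D, whose off-diagonal entries vanish.
   In the subspace lattice of F^n an interval [u,w] is, through a complement of u in w,
   isomorphic to the subspace lattice of a space of dimension m = dim w - dim u, and orthogonal
   complements map it onto another such interval with the ranks reversed. For odd m this
   reversal changes every sign, so the signed sum over [u,w] is zero. *)

section \<open>The incidence algebra of a finite poset\<close>

(* An element of the incidence algebra of P over the integers is a function vanishing off the
   pairs u \<le> w of P, and conv is the product of the algebra; with this normalisation the
   algebra laws below are equations between functions. *)
definition incidence :: "'b::order set \<Rightarrow> ('b \<Rightarrow> 'b \<Rightarrow> int) \<Rightarrow> bool" where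
  "incidence P f \<longleftrightarrow> (\<forall>u w. f u w \<noteq> 0 \<longrightarrow> u \<in> P \<and> w \<in> P \<and> u \<le> w)"

definition conv :: "'b::order set \<Rightarrow> ('b \<Rightarrow> 'b \<Rightarrow> int) \<Rightarrow> ('b \<Rightarrow> 'b \<Rightarrow> int) \<Rightarrow> 'b \<Rightarrow> 'b \<Rightarrow> int" where
  "conv P f g u w = (if u \<in> P \<and> w \<in> P then \<Sum>c\<in>P \<inter> {u..w}. f u c * g c w else 0)"

definition diag :: "'b::order set \<Rightarrow> ('b \<Rightarrow> int) \<Rightarrow> 'b \<Rightarrow> 'b \<Rightarrow> int" where
  "diag P s u w = (if u \<in> P \<and> u = w then s u else 0)"

abbreviation delta :: "'b::order set \<Rightarrow> 'b \<Rightarrow> 'b \<Rightarrow> int" where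
  "delta P \<equiv> diag P (\<lambda>_. 1)"

definition zeta :: "'b::order set \<Rightarrow> 'b \<Rightarrow> 'b \<Rightarrow> int" where
  "zeta P u w = (if u \<in> P \<and> w \<in> P \<and> u \<le> w then 1 else 0)"

lemma incidence_eqI:
  assumes "incidence P f" "incidence P g"
    and "\<And>u w. u \<in> P \<Longrightarrow> w \<in> P \<Longrightarrow> u \<le> w \<Longrightarrow> f u w = g u w"
  shows "f = g"
  using assms unfolding incidence_def by (metis ext)

lemma incidence_conv: "incidence P (conv P f g)"
  unfolding incidence_def
proof (intro allI impI)
  fix u w assume nz: "conv P f g u w \<noteq> 0"
  show "u \<in> P \<and> w \<in> P \<and> u \<le> w"
  proof (cases "u \<le> w")
    case False
    then show ?thesis
      using nz by (simp add: conv_def split: if_splits)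
  qed (use nz in \<open>simp add: conv_def split: if_splits\<close>)
qed

lemma incidence_diag: "incidence P (diag P s)"
  unfolding incidence_def diag_def by auto

lemma incidence_zeta: "incidence P (zeta P)"
  unfolding incidence_def zeta_def by auto

lemma conv_assoc:
  fixes P :: "'b::{order,finite} set"
  shows "conv P (conv P f g) h = conv P f (conv P g h)"
proof (intro ext)
  fix u w
  show "conv P (conv P f g) h u w = conv P f (conv P g h) u w"
  proof (cases "u \<in> P \<and> w \<in> P")
    case True
    let ?I = "P \<inter> {u..w}"
    have "conv P (conv P f g) h u w = (\<Sum>d\<in>?I. \<Sum>c\<in>{c\<in>?I. c \<le> d}. f u c * g c d * h d w)"
      using True unfolding conv_def
      by (auto simp: sum_distrib_right intro!: sum.cong dest: order_trans)
    also have "\<dots> = (\<Sum>c\<in>?I. \<Sum>d\<in>{d\<in>?I. c \<le> d}. f u c * g c d * h d w)"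
      by (rule sum.swap_restrict) simp_all
    also have "\<dots> = conv P f (conv P g h) u w"
      using True unfolding conv_def
      by (auto simp: sum_distrib_left mult.assoc intro!: sum.cong dest: order_trans)
    finally show ?thesis .
  qed (auto simp: conv_def)
qed

lemma conv_diag_left:
  fixes P :: "'b::{order,finite} set"
  assumes "incidence P f"
  shows "conv P (diag P s) f = (\<lambda>u w. s u * f u w)"
proof (intro ext)
  fix u w
  show "conv P (diag P s) f u w = s u * f u w"
  proof (cases "u \<in> P \<and> w \<in> P \<and> u \<le> w")
    case True
    then show ?thesis
      by (simp add: conv_def diag_def if_distrib[of "\<lambda>x. x * _"] cong: if_cong)
  next
    case False
    then show ?thesis
      using assms by (auto simp: conv_def incidence_def)
  qed
qed

lemma conv_diag_right:
  fixes P :: "'b::{order,finite} set"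
  assumes "incidence P f"
  shows "conv P f (diag P s) = (\<lambda>u w. f u w * s w)"
proof (intro ext)
  fix u w
  show "conv P f (diag P s) u w = f u w * s w"
  proof (cases "u \<in> P \<and> w \<in> P \<and> u \<le> w")
    case True
    then show ?thesis
      by (simp add: conv_def diag_def if_distrib[of "\<lambda>x. _ * x"] cong: if_cong)
  next
    case False
    then show ?thesis
      using assms by (auto simp: conv_def incidence_def)
  qed
qed

lemma conv_delta_left:
  fixes P :: "'b::{order,finite} set"
  shows "incidence P f \<Longrightarrow> conv P (delta P) f = f"
  by (simp add: conv_diag_left)

lemma conv_delta_right:
  fixes P :: "'b::{order,finite} set"
  shows "incidence P f \<Longrightarrow> conv P f (delta P) = f"
  by (simp add: conv_diag_right)

lemma conv_diag_diag:
  fixes P :: "'b::{order,finite} set"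
  shows "conv P (diag P s) (diag P s') = diag P (\<lambda>c. s c * s' c)"
  by (auto simp: conv_diag_left incidence_diag diag_def intro!: ext)

function mu :: "'b::{order,finite} set \<Rightarrow> 'b \<Rightarrow> 'b \<Rightarrow> int" where
  "mu P u w =
    (if u \<in> P \<and> w \<in> P \<and> u \<le> w then if u = w then 1 else - (\<Sum>c\<in>P \<inter> {u..<w}. mu P u c)
     else 0)"
  by auto
termination
  by (relation "Wellfounded.measure (\<lambda>(P, u, w). card {u..w})") (auto intro!: psubset_card_mono)

function nu :: "'b::{order,finite} set \<Rightarrow> 'b \<Rightarrow> 'b \<Rightarrow> int" where
  "nu P u w =
    (if u \<in> P \<and> w \<in> P \<and> u \<le> w then if u = w then 1 else - (\<Sum>c\<in>P \<inter> {u<..w}. nu P c w)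
     else 0)"
  by auto
termination
  by (relation "Wellfounded.measure (\<lambda>(P, u, w). card {u..w})") (auto intro!: psubset_card_mono)

declare mu.simps[simp del] nu.simps[simp del]

lemma incidence_mu: "incidence P (mu P)"
  unfolding incidence_def by (subst mu.simps) auto

lemma incidence_nu: "incidence P (nu P)"
  unfolding incidence_def by (subst nu.simps) auto

lemma conv_mu_zeta: "conv P (mu P) (zeta P) = delta P"
proof (rule incidence_eqI[OF incidence_conv incidence_diag])
  fix u w assume uw: "u \<in> P" "w \<in> P" "u \<le> w"
  have "conv P (mu P) (zeta P) u w = (\<Sum>c\<in>P \<inter> {u..w}. mu P u c)"
    using uw by (simp add: conv_def zeta_def)
  also have "\<dots> = delta P u w"
  proof (cases "u = w")
    case True
    then show ?thesis
      using uw by (simp add: diag_def mu.simps)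
  next
    case False
    then have "P \<inter> {u..w} = insert w (P \<inter> {u..<w})"
      using uw by auto
    then show ?thesis
      using False uw by (simp add: diag_def mu.simps[of P u w])
  qed
  finally show "conv P (mu P) (zeta P) u w = delta P u w" .
qed

lemma conv_zeta_nu: "conv P (zeta P) (nu P) = delta P"
proof (rule incidence_eqI[OF incidence_conv incidence_diag])
  fix u w assume uw: "u \<in> P" "w \<in> P" "u \<le> w"
  have "conv P (zeta P) (nu P) u w = (\<Sum>c\<in>P \<inter> {u..w}. nu P c w)"
    using uw by (simp add: conv_def zeta_def)
  also have "\<dots> = delta P u w"
  proof (cases "u = w")
    case True
    then show ?thesis
      using uw by (simp add: diag_def nu.simps)
  next
    case False
    then have "P \<inter> {u..w} = insert u (P \<inter> {u<..w})"
      using uw by auto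
    then show ?thesis
      using False uw by (simp add: diag_def nu.simps[of P u w])
  qed
  finally show "conv P (zeta P) (nu P) u w = delta P u w" .
qed

lemma left_inverse_eq_right_inverse:
  fixes P :: "'b::{order,finite} set"
  assumes "incidence P g" "incidence P h" "conv P g f = delta P" "conv P f h = delta P"
  shows "g = h"
proof -
  have "g = conv P g (conv P f h)"
    using assms by (simp add: conv_delta_right)
  also have "\<dots> = conv P (conv P g f) h"
    by (simp add: conv_assoc)
  also have "\<dots> = h"
    using assms by (simp add: conv_delta_left)
  finally show ?thesis .
qed

lemma mu_eq_nu: "mu P = nu P"
  by (rule left_inverse_eq_right_inverse[OF incidence_mu incidence_nu conv_mu_zeta conv_zeta_nu])

lemma conv_zeta_mu: "conv P (zeta P) (mu P) = delta P"
  by (simp add: mu_eq_nu conv_zeta_nu)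

lemma conv_commute_inverse:
  fixes P :: "'b::{order,finite} set"
  assumes "conv P a b = conv P b a" "conv P b b' = delta P" "conv P b' b = delta P"
  shows "conv P a b' = conv P b' a"
proof -
  have "conv P a b' = conv P (conv P b' b) (conv P a b')"
    using assms(3) by (simp add: conv_delta_left incidence_conv)
  also have "\<dots> = conv P b' (conv P (conv P b a) b')"
    by (simp add: conv_assoc)
  also have "\<dots> = conv P (conv P b' a) (conv P b b')"
    by (simp add: assms(1)[symmetric] conv_assoc)
  also have "\<dots> = conv P b' a"
    using assms(2) by (simp add: conv_delta_right incidence_conv)
  finally show ?thesis .
qed

lemma conv_zeta_left:
  "u \<in> P \<Longrightarrow> w \<in> P \<Longrightarrow> conv P (zeta P) f u w = (\<Sum>c\<in>P \<inter> {u..w}. f c w)"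
  by (auto simp: conv_def zeta_def intro!: sum.cong)

lemma conv_zeta_right:
  "u \<in> P \<Longrightarrow> w \<in> P \<Longrightarrow> conv P f (zeta P) u w = (\<Sum>c\<in>P \<inter> {u..w}. f u c)"
  by (auto simp: conv_def zeta_def intro!: sum.cong)

lemma conv_diag_conj:
  fixes P :: "'b::{order,finite} set"
  assumes "incidence P f"
  shows "conv P (diag P s) (conv P f (diag P s)) = (\<lambda>u w. s u * f u w * s w)"
  by (simp only: conv_diag_left[OF incidence_conv]) (simp add: conv_diag_right[OF assms] mult.assoc)

lemma conv_conj:
  fixes P :: "'b::{order,finite} set"
  assumes "conv P d d = delta P"
  shows "conv P (conv P d (conv P f d)) (conv P d (conv P g d)) = conv P d (conv P (conv P f g) d)"
proof -
  have "conv P (conv P d (conv P f d)) (conv P d (conv P g d))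
      = conv P d (conv P f (conv P (conv P d d) (conv P g d)))"
    by (simp add: conv_assoc)
  also have "\<dots> = conv P d (conv P (conv P f g) d)"
    using assms by (simp add: conv_delta_left incidence_conv conv_assoc)
  finally show ?thesis .
qed

lemma conv_zeta_commute_conj_zeta:
  fixes P :: "'b::{order,finite} set"
  assumes "\<And>u w. u \<in> P \<Longrightarrow> w \<in> P \<Longrightarrow> u \<le> w \<Longrightarrow> s u \<noteq> s w \<Longrightarrow> (\<Sum>c\<in>P \<inter> {u..w}. s c) = 0"
  shows "conv P (zeta P) (conv P (diag P s) (conv P (zeta P) (diag P s)))
       = conv P (conv P (diag P s) (conv P (zeta P) (diag P s))) (zeta P)"
proof (rule incidence_eqI[OF incidence_conv incidence_conv])
  fix u w assume uw: "u \<in> P" "w \<in> P" "u \<le> w"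
  have "conv P (zeta P) (conv P (diag P s) (conv P (zeta P) (diag P s))) u w
      = (\<Sum>c\<in>P \<inter> {u..w}. s c) * s w"
    unfolding conv_zeta_left[OF uw(1,2)] conv_diag_conj[OF incidence_zeta] sum_distrib_right
    using uw by (intro sum.cong refl) (simp add: zeta_def)
  moreover have "conv P (conv P (diag P s) (conv P (zeta P) (diag P s))) (zeta P) u w
      = s u * (\<Sum>c\<in>P \<inter> {u..w}. s c)"
    unfolding conv_zeta_right[OF uw(1,2)] conv_diag_conj[OF incidence_zeta] sum_distrib_left
    using uw by (intro sum.cong refl) (simp add: zeta_def)
  ultimately show "conv P (zeta P) (conv P (diag P s) (conv P (zeta P) (diag P s))) u w
      = conv P (conv P (diag P s) (conv P (zeta P) (diag P s))) (zeta P) u w"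
    using assms[OF uw] by (cases "s u = s w") simp_all
qed

lemma sum_chains_eq_conv:
  fixes P :: "'b::{order,finite} set"
  assumes "b \<in> P" "t \<in> P" "\<And>c. c \<in> P \<Longrightarrow> b \<le> c \<and> c \<le> t"
  shows "(\<Sum>(x, y, z)\<in>{(x, y, z). x \<in> P \<and> y \<in> P \<and> z \<in> P \<and> x \<le> y \<and> y \<le> z}. f x y * g y z)
       = conv P (zeta P) (conv P (conv P f g) (zeta P)) b t"
proof -
  have "(\<Sum>(x, y, z)\<in>{(x, y, z). x \<in> P \<and> y \<in> P \<and> z \<in> P \<and> x \<le> y \<and> y \<le> z}. f x y * g y z)
      = (\<Sum>(x, z, y)\<in>(SIGMA x:P. SIGMA z:P \<inter> {x..t}. P \<inter> {x..z}). f x y * g y z)"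
    using assms(3)
    by (intro sum.reindex_bij_witness[where i = "\<lambda>(x, z, y). (x, y, z)" and j = "\<lambda>(x, y, z). (x, z, y)"])
      (auto dest: order.trans)
  also have "\<dots> = (\<Sum>x\<in>P. \<Sum>z\<in>P \<inter> {x..t}. \<Sum>y\<in>P \<inter> {x..z}. f x y * g y z)"
    by (simp add: sum.Sigma)
  also have "\<dots> = (\<Sum>x\<in>P. \<Sum>z\<in>P \<inter> {x..t}. conv P f g x z)"
    by (intro sum.cong refl) (auto simp: conv_def)
  also have "\<dots> = (\<Sum>x\<in>P. conv P (conv P f g) (zeta P) x t)"
    using assms(2) by (intro sum.cong refl) (simp add: conv_zeta_right)
  also have "\<dots> = conv P (zeta P) (conv P (conv P f g) (zeta P)) b t"
  proof -
    have "P \<inter> {b..t} = P"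
      using assms(3) by auto
    then show ?thesis
      by (simp add: conv_zeta_left[OF assms(1,2)])
  qed
  finally show ?thesis .
qed

lemma sum_chains_mu_signs_eq_0:
  fixes P :: "'b::{order,finite} set" and s :: "'b \<Rightarrow> int"
  assumes sq: "\<And>c. c \<in> P \<Longrightarrow> s c * s c = 1"
    and parity: "\<And>u w. u \<in> P \<Longrightarrow> w \<in> P \<Longrightarrow> u \<le> w \<Longrightarrow> s u \<noteq> s w \<Longrightarrow> (\<Sum>c\<in>P \<inter> {u..w}. s c) = 0"
    and bounds: "b \<in> P" "t \<in> P" "b \<noteq> t" "\<And>c. c \<in> P \<Longrightarrow> b \<le> c \<and> c \<le> t"
  shows "(\<Sum>(x, y, z)\<in>{(x, y, z). x \<in> P \<and> y \<in> P \<and> z \<in> P \<and> x \<le> y \<and> y \<le> z}.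
           s x * mu P x y * s y * (mu P y z * s z)) = 0"
proof -
  let ?D = "diag P s" and ?Z = "zeta P" and ?M = "mu P"
  let ?T = "conv P ?D (conv P ?Z ?D)" and ?M' = "conv P ?D (conv P ?M ?D)"
  have DD: "conv P ?D ?D = delta P"
    using sq by (auto simp: conv_diag_diag diag_def intro!: ext)
  have DdeltaD: "conv P ?D (conv P (delta P) ?D) = delta P"
    by (simp add: conv_delta_left incidence_diag DD)
  have "conv P ?T ?M' = delta P" "conv P ?M' ?T = delta P"
    by (simp_all add: conv_conj[OF DD] conv_zeta_mu conv_mu_zeta DdeltaD)
  then have comm: "conv P ?Z ?M' = conv P ?M' ?Z"
    using conv_commute_inverse conv_zeta_commute_conj_zeta[OF parity] by blast
  have "(\<Sum>(x, y, z)\<in>{(x, y, z). x \<in> P \<and> y \<in> P \<and> z \<in> P \<and> x \<le> y \<and> y \<le> z}.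
          s x * mu P x y * s y * (mu P y z * s z))
      = conv P ?Z (conv P (conv P ?M' (conv P ?M ?D)) ?Z) b t"
    by (subst conv_diag_conj[OF incidence_mu], subst conv_diag_right[OF incidence_mu])
      (rule sum_chains_eq_conv[OF bounds(1,2,4)])
  also have "conv P ?Z (conv P (conv P ?M' (conv P ?M ?D)) ?Z)
      = conv P (conv P ?Z ?M') (conv P ?M (conv P ?D ?Z))"
    by (simp add: conv_assoc)
  also have "\<dots> = conv P ?M' (conv P (conv P ?Z ?M) (conv P ?D ?Z))"
    by (simp add: comm conv_assoc)
  also have "\<dots> = conv P ?D (conv P ?M (conv P (conv P ?D ?D) ?Z))"
    by (simp add: conv_zeta_mu conv_delta_left incidence_conv conv_assoc)
  also have "\<dots> = ?D"
    by (simp add: DD conv_delta_left incidence_zeta conv_mu_zeta conv_delta_right incidence_diag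
        flip: conv_assoc)
  finally show ?thesis
    using bounds(3) by (simp add: diag_def)
qed

lemma sum_intervals_mu_mu:
  fixes P :: "'b::{order,finite} set"
  assumes "x \<in> P" "y \<in> P" "z \<in> P"
  shows "(\<Sum>(a, b)\<in>(P \<inter> {x..y}) \<times> (P \<inter> {y..z}). mu P a y * mu P y b) = delta3 x y z"
proof -
  have "(\<Sum>(a, b)\<in>(P \<inter> {x..y}) \<times> (P \<inter> {y..z}). mu P a y * mu P y b)
      = (\<Sum>a\<in>P \<inter> {x..y}. mu P a y) * (\<Sum>b\<in>P \<inter> {y..z}. mu P y b)"
    by (simp add: sum_product sum.cartesian_product)
  also have "\<dots> = conv P (zeta P) (mu P) x y * conv P (mu P) (zeta P) y z"
    using assms by (simp add: conv_zeta_left conv_zeta_right)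
  also have "\<dots> = delta3 x y z"
    using assms by (simp add: conv_zeta_mu conv_mu_zeta diag_def delta3_def)
  finally show ?thesis .
qed

lemma Int_atLeastAtMost_psubset:
  fixes a b x z :: "'b::order"
  assumes "x \<le> a" "a \<le> b" "b \<le> z" "(a, b) \<noteq> (x, z)" "x \<in> P" "z \<in> P"
  shows "P \<inter> {a..b} \<subset> P \<inter> {x..z}"
proof
  show "P \<inter> {a..b} \<subseteq> P \<inter> {x..z}"
    using assms(1,3) by auto
  have "x \<le> z"
    using assms(1-3) by (meson order.trans)
  then have "x \<in> P \<inter> {x..z}" "z \<in> P \<inter> {x..z}"
    using assms(5,6) by auto
  moreover have "x \<notin> {a..b} \<or> z \<notin> {a..b}"
    using assms(1,3,4) by auto
  ultimately show "P \<inter> {a..b} \<noteq> P \<inter> {x..z}"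
    by blast
qed

lemma triangular_sums_unique:
  fixes P :: "'b::{order,finite} set" and J J' :: "'b \<Rightarrow> 'b \<Rightarrow> 'b \<Rightarrow> int"
  assumes sums: "\<And>x y z. x \<in> P \<Longrightarrow> y \<in> P \<Longrightarrow> z \<in> P \<Longrightarrow> x \<le> y \<Longrightarrow> y \<le> z \<Longrightarrow>
      (\<Sum>(a, b)\<in>(P \<inter> {x..y}) \<times> (P \<inter> {y..z}). J a y b)
      = (\<Sum>(a, b)\<in>(P \<inter> {x..y}) \<times> (P \<inter> {y..z}). J' a y b)"
    and "x \<in> P" "y \<in> P" "z \<in> P" "x \<le> y" "y \<le> z"
  shows "J x y z = J' x y z"
  using assms(2-)
proof (induction "card (P \<inter> {x..z})" arbitrary: x z rule: less_induct)
  case less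
  let ?S = "(P \<inter> {x..y}) \<times> (P \<inter> {y..z})"
  have smaller: "(\<lambda>(a, b). J a y b) p = (\<lambda>(a, b). J' a y b) p" if "p \<in> ?S - {(x, z)}" for p
  proof -
    obtain a b where p: "p = (a, b)"
      by (cases p)
    have ab: "a \<in> P" "b \<in> P" "x \<le> a" "a \<le> y" "y \<le> b" "b \<le> z" "(a, b) \<noteq> (x, z)"
      using that unfolding p by auto
    have "P \<inter> {a..b} \<subset> P \<inter> {x..z}"
      using ab(3) order.trans[OF ab(4,5)] ab(6,7) less.prems(1,3) by (rule Int_atLeastAtMost_psubset)
    then have "card (P \<inter> {a..b}) < card (P \<inter> {x..z})"
      by (rule psubset_card_mono[OF finite])
    then show ?thesis
      unfolding p using less.hyps ab(1-6) less.prems(2) by simp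
  qed
  have "(x, z) \<in> ?S"
    using less.prems by auto
  then have "(\<Sum>(a, b)\<in>?S. J a y b) = J x y z + (\<Sum>(a, b)\<in>?S - {(x, z)}. J a y b)"
    "(\<Sum>(a, b)\<in>?S. J' a y b) = J' x y z + (\<Sum>(a, b)\<in>?S - {(x, z)}. J' a y b)"
    using sum.remove[OF finite_class.finite \<open>(x, z) \<in> ?S\<close>, of "\<lambda>(a, b). J a y b"]
      sum.remove[OF finite_class.finite \<open>(x, z) \<in> ?S\<close>, of "\<lambda>(a, b). J' a y b"]
    by simp_all
  moreover note sums[OF less.prems]
  moreover have "(\<Sum>(a, b)\<in>?S - {(x, z)}. J a y b) = (\<Sum>(a, b)\<in>?S - {(x, z)}. J' a y b)"
    by (rule sum.cong[OF refl smaller])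
  ultimately show ?case
    by simp
qed

lemma Jfun_eq_mu_mu:
  fixes P :: "'b::{order,finite} set"
  shows "Jfun P (\<le>) = (\<lambda>x y z. mu P x y * mu P y z)"
proof -
  define solves where "solves J \<longleftrightarrow>
      (\<forall>x\<in>P. \<forall>y\<in>P. \<forall>z\<in>P. x \<le> y \<and> y \<le> z \<longrightarrow>
        (\<Sum>(a, b)\<in>(P \<inter> {x..y}) \<times> (P \<inter> {y..z}). J a y b) = delta3 x y z) \<and>
      (\<forall>x y z. \<not> (x \<in> P \<and> y \<in> P \<and> z \<in> P \<and> x \<le> y \<and> y \<le> z) \<longrightarrow> J x y z = 0)"
    for J :: "'b \<Rightarrow> 'b \<Rightarrow> 'b \<Rightarrow> int"
  have "{(a, b). a \<in> P \<and> b \<in> P \<and> x \<le> a \<and> a \<le> y \<and> y \<le> b \<and> b \<le> z}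
      = (P \<inter> {x..y}) \<times> (P \<inter> {y..z})" for x y z
    by auto
  then have "Jfun P (\<le>) = (THE J. solves J)"
    unfolding Jfun_def solves_def by simp
  also have "\<dots> = (\<lambda>x y z. mu P x y * mu P y z)"
  proof (rule the_equality)
    have "mu P x y * mu P y z = 0" if "\<not> (x \<in> P \<and> y \<in> P \<and> z \<in> P \<and> x \<le> y \<and> y \<le> z)" for x y z
      using that incidence_mu[of P] unfolding incidence_def by auto
    then show mu_solves: "solves (\<lambda>x y z. mu P x y * mu P y z)"
      unfolding solves_def by (simp add: sum_intervals_mu_mu)
    fix J assume J: "solves J"
    have "(\<Sum>(a, b)\<in>(P \<inter> {x..y}) \<times> (P \<inter> {y..z}). J a y b)
        = (\<Sum>(a, b)\<in>(P \<inter> {x..y}) \<times> (P \<inter> {y..z}). mu P a y * mu P y b)"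
      if "x \<in> P" "y \<in> P" "z \<in> P" "x \<le> y" "y \<le> z" for x y z
      using J mu_solves that unfolding solves_def by simp
    note on_chains = triangular_sums_unique[where J' = "\<lambda>x y z. mu P x y * mu P y z", OF this]
    show "J = (\<lambda>x y z. mu P x y * mu P y z)"
    proof (intro ext)
      fix x y z
      show "J x y z = mu P x y * mu P y z"
        using on_chains[of x y z] J mu_solves unfolding solves_def
        by (cases "x \<in> P \<and> y \<in> P \<and> z \<in> P \<and> x \<le> y \<and> y \<le> z") auto
    qed
  qed
  finally show ?thesis .
qed

lemma Mpoly_minus_one_eq_0:
  fixes P :: "'b::{order,finite} set" and rk :: "'b \<Rightarrow> nat"
  assumes parity: "\<And>u w. u \<in> P \<Longrightarrow> w \<in> P \<Longrightarrow> u \<le> w \<Longrightarrow> odd (rk u + rk w)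
      \<Longrightarrow> (\<Sum>c\<in>P \<inter> {u..w}. (-1::int) ^ rk c) = 0"
    and bounds: "b \<in> P" "t \<in> P" "b \<noteq> t" "\<And>c. c \<in> P \<Longrightarrow> b \<le> c \<and> c \<le> t"
  shows "Mpoly P (\<le>) rk (-1::int) = 0"
proof -
  define r where "r = maxrank P rk"
  define s where "s c = (-1::int) ^ rk c" for c
  have sign: "(-1::int) ^ nat (rho P rk x y z) = (-1) ^ (3 * r) * (s x * s y * s z)"
    if "x \<in> P" "y \<in> P" "z \<in> P" for x y z
  proof -
    have "rk x \<le> r" "rk y \<le> r" "rk z \<le> r"
      using that unfolding r_def maxrank_def by simp_all
    then have "rk x + rk y + rk z \<le> 3 * r"
      by linarith
    moreover have "nat (rho P rk x y z) = 3 * r - (rk x + rk y + rk z)"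
      unfolding rho_def r_def[symmetric] by linarith
    ultimately show ?thesis
      unfolding s_def by (simp add: neg_one_power_add_eq_neg_one_power_diff[symmetric] power_add)
  qed
  have sq: "s c * s c = 1" for c
    by (simp add: s_def flip: power_add)
  have parity': "(\<Sum>c\<in>P \<inter> {u..w}. s c) = 0" if "u \<in> P" "w \<in> P" "u \<le> w" "s u \<noteq> s w" for u w
    using parity[OF that(1-3)] that(4) unfolding s_def
    by (auto simp: minus_one_power_iff split: if_splits)
  have "Mpoly P (\<le>) rk (-1::int)
      = (\<Sum>(x, y, z)\<in>{(x, y, z). x \<in> P \<and> y \<in> P \<and> z \<in> P \<and> x \<le> y \<and> y \<le> z}.
           (-1) ^ (3 * r) * (s x * mu P x y * s y * (mu P y z * s z)))"
    unfolding Mpoly_def Jfun_eq_mu_mu by (intro sum.cong refl) (auto simp: sign algebra_simps)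
  also have "\<dots> = (-1) ^ (3 * r) *
      (\<Sum>(x, y, z)\<in>{(x, y, z). x \<in> P \<and> y \<in> P \<and> z \<in> P \<and> x \<le> y \<and> y \<le> z}.
         s x * mu P x y * s y * (mu P y z * s z))"
    by (simp add: sum_distrib_left split_def)
  also have "\<dots> = 0"
    using sum_chains_mu_signs_eq_0[OF sq parity' bounds] by simp
  finally show ?thesis .
qed


section \<open>Intervals in the lattice of subspaces of F^n\<close>

definition vdot :: "'a::field^'n \<Rightarrow> 'a^'n \<Rightarrow> 'a" where
  "vdot x y = (\<Sum>i\<in>UNIV. x$i * y$i)"

definition perp :: "('a::field^'n) set \<Rightarrow> ('a^'n) set" where
  "perp S = {x. \<forall>y\<in>S. vdot x y = 0}"

lemma vdot_commute: "vdot x y = vdot y x"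
  unfolding vdot_def by (simp add: mult.commute)

lemma subspace_vdot_eq_0: "vec.subspace {x. vdot x y = 0}"
  unfolding vec.subspace_def vdot_def
  by (simp add: algebra_simps sum.distrib sum_distrib_left[symmetric])

lemma subspace_perp: "vec.subspace (perp S)"
proof -
  have "perp S = (\<Inter>y\<in>S. {x. vdot x y = 0})"
    unfolding perp_def by auto
  then show ?thesis
    by (simp add: vec.subspace_Inter subspace_vdot_eq_0)
qed

lemma perp_antimono: "S \<subseteq> T \<Longrightarrow> perp T \<subseteq> perp S"
  unfolding perp_def by auto

lemma subset_perp_perp: "S \<subseteq> perp (perp S)"
  unfolding perp_def by (auto simp: vdot_commute)

lemma perp_span: "perp (vec.span S) = perp S"
proof
  show "perp (vec.span S) \<subseteq> perp S"
    by (intro perp_antimono vec.span_superset)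
  show "perp S \<subseteq> perp (vec.span S)"
  proof
    fix x assume "x \<in> perp S"
    then have "S \<subseteq> {y. vdot y x = 0}"
      unfolding perp_def by (auto simp: vdot_commute)
    then have "vec.span S \<subseteq> {y. vdot y x = 0}"
      by (rule vec.span_minimal[OF _ subspace_vdot_eq_0])
    then show "x \<in> perp (vec.span S)"
      unfolding perp_def by (auto simp: vdot_commute)
  qed
qed

lemma dim_vimage_bij_linear:
  fixes f :: "'a::field^'n \<Rightarrow> 'a^'n"
  assumes "Vector_Spaces.linear (*s) (*s) f" "bij f"
  shows "vec.dim (f -` E) = vec.dim E"
  using vec.dim_image_eq[OF assms(1) inj_on_subset[OF bij_is_inj[OF assms(2)] subset_UNIV]]
  by (metis assms(2) bij_is_surj surj_image_vimage_eq)

(* Over a finite field the form vdot is isotropic, so perp S need not be a complement of S;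
   the dimension count goes through the invertible matrix whose rows are a basis extending one
   of S. *)
lemma dim_perp:
  fixes S :: "('a::field^'n) set"
  assumes "vec.subspace S"
  shows "vec.dim (perp S) + vec.dim S = CARD('n)"
proof -
  obtain B where B: "B \<subseteq> S" "vec.independent B" "S \<subseteq> vec.span B" "card B = vec.dim S"
    using vec.basis_exists by blast
  obtain C where C: "B \<subseteq> C" "C \<subseteq> UNIV" "vec.independent C" "UNIV \<subseteq> vec.span C"
    by (rule vec.maximal_independent_subset_extend[OF subset_UNIV B(2)])
  have "card (UNIV :: 'n set) = card C"
    using vec.basis_card_eq_dim[OF C(2,4,3)] vec_dim_card by metis
  then obtain \<sigma> where \<sigma>: "bij_betw \<sigma> (UNIV :: 'n set) C"
    using finite_same_card_bij[OF finite_class.finite_UNIV vec.finiteI_independent[OF C(3)]] by blast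
  then have range_\<sigma>: "range \<sigma> = C"
    by (simp add: bij_betw_def)
  define M :: "'a^'n^'n" where "M = (\<chi> i. \<sigma> i)"
  have "rows M = C"
    unfolding rows_def row_def M_def range_\<sigma>[symmetric] by (auto simp: vec_lambda_eta)
  then have "bij ((*v) M)"
    using C(4) by (simp add: invertible_eq_bij[symmetric] invertible_left_inverse
        matrix_left_invertible_span_rows_gen top.extremum_unique)
  have Mv: "(M *v x) $ i = vdot x (\<sigma> i)" for x i
    unfolding M_def vdot_def matrix_vector_mult_def by (simp add: mult.commute)
  define I where "I = \<sigma> -` B"
  have B_eq: "B = \<sigma> ` I"
    using C(1) range_\<sigma> unfolding I_def by auto
  define E :: "('a^'n) set" where "E = {y. \<forall>i. i \<notin> - I \<longrightarrow> y $ i = 0}"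
  have "perp S = perp B"
    using B assms by (metis perp_span vec.span_subspace)
  also have "\<dots> = (*v) M -` E"
    unfolding perp_def E_def B_eq by (auto simp: Mv)
  finally have "vec.dim (perp S) = vec.dim E"
    by (simp add: dim_vimage_bij_linear[OF matrix_vector_mul_linear_gen \<open>bij ((*v) M)\<close>])
  moreover have "vec.dim E = CARD('n) - card I"
    unfolding E_def dim_substandard_cart by (simp add: Compl_eq_Diff_UNIV card_Diff_subset)
  moreover have "card I = vec.dim S"
    using B(4) B_eq card_image bij_betw_imp_inj_on[OF \<sigma>] by (metis inj_on_subset subset_UNIV)
  moreover have "card I \<le> CARD('n)"
    by (simp add: card_mono)
  ultimately show ?thesis
    by linarith
qed

lemma perp_perp:
  fixes S :: "('a::field^'n) set"
  assumes "vec.subspace S"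
  shows "perp (perp S) = S"
proof -
  have "vec.dim (perp (perp S)) = vec.dim S"
    using dim_perp[OF assms] dim_perp[OF subspace_perp[of S]] by simp
  then show ?thesis
    using vec.subspace_dim_equal[OF assms subspace_perp subset_perp_perp] by simp
qed

definition subspaces_between :: "('a::field^'n) set \<Rightarrow> ('a^'n) set \<Rightarrow> ('a^'n) set set" where
  "subspaces_between u w = {c. vec.subspace c \<and> u \<subseteq> c \<and> c \<subseteq> w}"

lemma bij_betw_perp_subspaces_between:
  fixes u w :: "('a::field^'n) set"
  assumes "vec.subspace u" "vec.subspace w"
  shows "bij_betw perp (subspaces_between u w) (subspaces_between (perp w) (perp u))"
proof (rule bij_betw_byWitness[where f' = perp])
  show "\<forall>c\<in>subspaces_between u w. perp (perp c) = c"
    "\<forall>d\<in>subspaces_between (perp w) (perp u). perp (perp d) = d"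
    by (simp_all add: subspaces_between_def perp_perp)
  show "perp ` subspaces_between u w \<subseteq> subspaces_between (perp w) (perp u)"
    by (auto simp: subspaces_between_def subspace_perp intro: perp_antimono[THEN subsetD])
  show "perp ` subspaces_between (perp w) (perp u) \<subseteq> subspaces_between u w"
  proof (rule image_subsetI)
    fix d assume "d \<in> subspaces_between (perp w) (perp u)"
    then have "perp (perp u) \<subseteq> perp d" "perp d \<subseteq> perp (perp w)"
      by (simp_all add: subspaces_between_def perp_antimono)
    then show "perp d \<in> subspaces_between u w"
      by (simp add: subspaces_between_def subspace_perp perp_perp assms)
  qed
qed

lemma subspace_complement_exists:
  fixes u w :: "('a::field^'n) set"
  assumes u: "vec.subspace u" and w: "vec.subspace w" and "u \<subseteq> w"
  obtains W where "vec.subspace W" "u \<inter> W = {0}" "{x + y |x y. x \<in> u \<and> y \<in> W} = w"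
proof -
  obtain B where B: "B \<subseteq> u" "vec.independent B" "u \<subseteq> vec.span B" "card B = vec.dim u"
    using vec.basis_exists by blast
  obtain C where C: "B \<subseteq> C" "C \<subseteq> w" "vec.independent C" "w \<subseteq> vec.span C"
    by (rule vec.maximal_independent_subset_extend[OF order_trans[OF B(1) \<open>u \<subseteq> w\<close>] B(2)])
  define W where "W = vec.span (C - B)"
  have span_B: "vec.span B = u"
    using B u by (metis vec.span_subspace)
  have span_C: "vec.span C = w"
    using C w by (metis vec.span_subspace)
  have sum: "{x + y |x y. x \<in> u \<and> y \<in> W} = w"
    using vec.span_Un[of B "C - B"] C(1) unfolding W_def span_B span_C[symmetric]
    by (simp add: Un_absorb1)
  have "vec.dim W = card C - card B"
    using vec.dim_span_eq_card_independent[OF vec.independent_mono[OF C(3)]] C(1)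
      vec.finiteI_independent[OF C(3)] unfolding W_def by (simp add: card_Diff_subset finite_subset)
  moreover have "card C = vec.dim w" "card B \<le> card C"
    using vec.basis_card_eq_dim[OF C(2,4,3)] card_mono[OF vec.finiteI_independent[OF C(3)] C(1)]
    by simp_all
  ultimately have "vec.dim (u \<inter> W) = 0"
    using vec.dim_sums_Int[OF u vec.subspace_span[of "C - B"]] sum B(4) unfolding W_def by simp
  then have "u \<inter> W = {0}"
    using vec.subspace_0[OF u] vec.subspace_0[OF vec.subspace_span[of "C - B"]]
    unfolding W_def by auto
  with sum show ?thesis
    using that[of W] unfolding W_def by simp
qed

lemma sums_Int_complement:
  fixes u c W :: "('a::field^'n) set"
  assumes "vec.subspace c" "u \<subseteq> c" "c \<subseteq> {x + y |x y. x \<in> u \<and> y \<in> W}"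
  shows "{x + y |x y. x \<in> u \<and> y \<in> c \<inter> W} = c"
proof
  show "{x + y |x y. x \<in> u \<and> y \<in> c \<inter> W} \<subseteq> c"
    using assms(1,2) by (auto intro: vec.subspace_add)
  show "c \<subseteq> {x + y |x y. x \<in> u \<and> y \<in> c \<inter> W}"
  proof
    fix z assume "z \<in> c"
    then obtain x y where "z = x + y" "x \<in> u" "y \<in> W"
      using assms(3) by blast
    moreover have "y \<in> c"
      using vec.subspace_diff[OF assms(1) \<open>z \<in> c\<close>, of x] assms(2) calculation by auto
    ultimately show "z \<in> {x + y |x y. x \<in> u \<and> y \<in> c \<inter> W}"
      by blast
  qed
qed

lemma dim_Int_complement:
  fixes u w W c :: "('a::field^'n) set"
  assumes "vec.subspace u" "vec.subspace W" "u \<inter> W = {0}"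
    and "{x + y |x y. x \<in> u \<and> y \<in> W} = w" and "c \<in> subspaces_between u w"
  shows "vec.dim (c \<inter> W) + vec.dim u = vec.dim c"
proof -
  have c: "vec.subspace c" "u \<subseteq> c" "c \<subseteq> w"
    using assms(5) by (simp_all add: subspaces_between_def)
  have "u \<inter> (c \<inter> W) = {0}"
    using assms(3) c(2) vec.subspace_0[OF c(1)] by blast
  then show ?thesis
    using vec.dim_sums_Int[OF assms(1) vec.subspace_inter[OF c(1) assms(2)]]
      sums_Int_complement[OF c(1,2)] c(3) assms(4) by simp
qed

lemma Int_sums_complement:
  fixes u d W :: "('a::field^'n) set"
  assumes W: "vec.subspace W" and "u \<inter> W = {0}" and "d \<subseteq> W" and "0 \<in> u"
  shows "{x + y |x y. x \<in> u \<and> y \<in> d} \<inter> W = d"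
proof (intro equalityI subsetI)
  fix z assume "z \<in> {x + y |x y. x \<in> u \<and> y \<in> d} \<inter> W"
  then obtain x y where "z = x + y" "x \<in> u" "y \<in> d" "z \<in> W"
    by blast
  moreover have "x \<in> W"
    using vec.subspace_diff[OF W \<open>z \<in> W\<close>, of y] \<open>d \<subseteq> W\<close> \<open>y \<in> d\<close> \<open>z = x + y\<close> by auto
  then have "x = 0"
    using \<open>x \<in> u\<close> \<open>u \<inter> W = {0}\<close> by blast
  ultimately show "z \<in> d"
    by simp
next
  fix z assume "z \<in> d"
  then have "z = 0 + z" "z \<in> W"
    using \<open>d \<subseteq> W\<close> by auto
  then show "z \<in> {x + y |x y. x \<in> u \<and> y \<in> d} \<inter> W"
    using \<open>z \<in> d\<close> \<open>0 \<in> u\<close> by blast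
qed

lemma bij_betw_Int_complement:
  fixes u w W :: "('a::field^'n) set"
  assumes u: "vec.subspace u" and W: "vec.subspace W" and "u \<inter> W = {0}"
    and w: "{x + y |x y. x \<in> u \<and> y \<in> W} = w"
  shows "bij_betw (\<lambda>c. c \<inter> W) (subspaces_between u w) (subspaces_between {0} W)"
proof (rule bij_betw_byWitness[where f' = "\<lambda>d. {x + y |x y. x \<in> u \<and> y \<in> d}"])
  show "\<forall>c\<in>subspaces_between u w. {x + y |x y. x \<in> u \<and> y \<in> c \<inter> W} = c"
    using sums_Int_complement w unfolding subspaces_between_def by blast
  show "(\<lambda>c. c \<inter> W) ` subspaces_between u w \<subseteq> subspaces_between {0} W"
    using W by (auto simp: subspaces_between_def vec.subspace_inter vec.subspace_0)
  show "\<forall>d\<in>subspaces_between {0} W. {x + y |x y. x \<in> u \<and> y \<in> d} \<inter> W = d"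
    using Int_sums_complement[OF W \<open>u \<inter> W = {0}\<close>] vec.subspace_0[OF u]
    by (simp add: subspaces_between_def)
  show "(\<lambda>d. {x + y |x y. x \<in> u \<and> y \<in> d}) ` subspaces_between {0} W \<subseteq> subspaces_between u w"
  proof (rule image_subsetI)
    fix d assume "d \<in> subspaces_between {0} W"
    then have d: "vec.subspace d" "0 \<in> d" "d \<subseteq> W"
      by (simp_all add: subspaces_between_def)
    have "u \<subseteq> {x + y |x y. x \<in> u \<and> y \<in> d}"
      using d(2) by force
    moreover have "{x + y |x y. x \<in> u \<and> y \<in> d} \<subseteq> w"
      using d(3) w by blast
    ultimately show "{x + y |x y. x \<in> u \<and> y \<in> d} \<in> subspaces_between u w"
      using vec.subspace_sums[OF u d(1)] by (simp add: subspaces_between_def)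
  qed
qed

lemma bij_betw_image_subspaces_between_0:
  fixes f :: "'a::field^'n \<Rightarrow> 'a^'n"
  assumes lin: "Vector_Spaces.linear (*s) (*s) f" and inj: "inj_on f W" and W: "vec.subspace W"
  shows "bij_betw ((`) f) (subspaces_between {0} W) (subspaces_between {0} (f ` W))"
proof (rule bij_betw_byWitness[where f' = "\<lambda>d. W \<inter> f -` d"])
  show "\<forall>c\<in>subspaces_between {0} W. W \<inter> f -` f ` c = c"
    using inj by (auto simp: subspaces_between_def inj_on_def)
  show "\<forall>d\<in>subspaces_between {0} (f ` W). f ` (W \<inter> f -` d) = d"
    by (auto simp: subspaces_between_def)
  show "(`) f ` subspaces_between {0} W \<subseteq> subspaces_between {0} (f ` W)"
    using vec.linear_subspace_image[OF lin] vec.linear_0[OF lin]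
    by (auto simp: subspaces_between_def)
  show "(\<lambda>d. W \<inter> f -` d) ` subspaces_between {0} (f ` W) \<subseteq> subspaces_between {0} W"
    using vec.subspace_inter[OF W vec.linear_subspace_vimage[OF lin]] vec.subspace_0[OF W]
      vec.linear_0[OF lin] by (auto simp: subspaces_between_def)
qed

lemma sum_subspaces_between_0_cong_dim:
  fixes W W' :: "('a::field^'n) set"
  assumes "vec.subspace W" "vec.subspace W'" "vec.dim W = vec.dim W'"
  shows "(\<Sum>c\<in>subspaces_between {0} W. g (vec.dim c)) = (\<Sum>c\<in>subspaces_between {0} W'. g (vec.dim c))"
proof -
  obtain B where B: "B \<subseteq> W" "vec.independent B" "W \<subseteq> vec.span B" "card B = vec.dim W"
    using vec.basis_exists by blast
  obtain C where C: "C \<subseteq> W'" "vec.independent C" "W' \<subseteq> vec.span C" "card C = vec.dim W'"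
    using vec.basis_exists by blast
  obtain f where f: "Vector_Spaces.linear (*s) (*s) f" "f ` W = W'" "inj_on f W"
    using vec.basis_to_basis_subspace_isomorphism[OF assms B C] by blast
  have "vec.dim (f ` c) = vec.dim c" if "c \<in> subspaces_between {0} W" for c
  proof -
    have "vec.span c = c" "c \<subseteq> W"
      using that by (simp_all add: subspaces_between_def vec.span_eq_iff)
    then show ?thesis
      using vec.dim_image_eq[OF f(1)] inj_on_subset[OF f(3)] by metis
  qed
  then show ?thesis
    using sum.reindex_bij_betw[OF bij_betw_image_subspaces_between_0[OF f(1,3) assms(1)],
        of "\<lambda>c. g (vec.dim c)"] f(2) by simp
qed

lemma sum_subspaces_between_eq_sum_complement:
  fixes u w W :: "('a::field^'n) set"
  assumes "vec.subspace u" "vec.subspace W" "u \<inter> W = {0}"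
    and "{x + y |x y. x \<in> u \<and> y \<in> W} = w"
  shows "(\<Sum>c\<in>subspaces_between u w. g (vec.dim c - vec.dim u))
       = (\<Sum>d\<in>subspaces_between {0} W. g (vec.dim d))"
proof -
  have "(\<Sum>c\<in>subspaces_between u w. g (vec.dim c - vec.dim u))
      = (\<Sum>c\<in>subspaces_between u w. g (vec.dim (c \<inter> W)))"
    using dim_Int_complement[OF assms] by (intro sum.cong refl) (metis add_diff_cancel_right')
  also have "\<dots> = (\<Sum>d\<in>subspaces_between {0} W. g (vec.dim d))"
    by (rule sum.reindex_bij_betw[OF bij_betw_Int_complement[OF assms]])
  finally show ?thesis .
qed

lemma sum_subspaces_between_shift:
  fixes u w u' w' :: "('a::field^'n) set"
  assumes "vec.subspace u" "vec.subspace w" "u \<subseteq> w"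
    and "vec.subspace u'" "vec.subspace w'" "u' \<subseteq> w'"
    and "vec.dim w - vec.dim u = vec.dim w' - vec.dim u'"
  shows "(\<Sum>c\<in>subspaces_between u w. g (vec.dim c - vec.dim u))
       = (\<Sum>c\<in>subspaces_between u' w'. g (vec.dim c - vec.dim u'))"
proof -
  obtain W where W: "vec.subspace W" "u \<inter> W = {0}" "{x + y |x y. x \<in> u \<and> y \<in> W} = w"
    using subspace_complement_exists[OF assms(1-3)] by blast
  obtain W' where W': "vec.subspace W'" "u' \<inter> W' = {0}" "{x + y |x y. x \<in> u' \<and> y \<in> W'} = w'"
    using subspace_complement_exists[OF assms(4-6)] by blast
  have "vec.dim W = vec.dim W'"
    using vec.dim_sums_Int[OF assms(1) W(1)] vec.dim_sums_Int[OF assms(4) W'(1)] W W' assms(7)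
    by simp
  then show ?thesis
    unfolding sum_subspaces_between_eq_sum_complement[OF assms(1) W]
      sum_subspaces_between_eq_sum_complement[OF assms(4) W']
    by (rule sum_subspaces_between_0_cong_dim[OF W(1) W'(1)])
qed

lemma sum_subspaces_between_reverse:
  fixes u w :: "('a::field^'n) set"
  assumes u: "vec.subspace u" and w: "vec.subspace w" and "u \<subseteq> w"
  shows "(\<Sum>c\<in>subspaces_between u w. g (vec.dim c - vec.dim u))
       = (\<Sum>c\<in>subspaces_between u w. g (vec.dim w - vec.dim c))"
proof -
  define m where "m = vec.dim w - vec.dim u"
  have dim_c: "vec.subspace c" "vec.dim u \<le> vec.dim c" "vec.dim c \<le> vec.dim w"
    if "c \<in> subspaces_between u w" for c
    using that vec.dim_subset by (auto simp: subspaces_between_def)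
  have "(\<Sum>c\<in>subspaces_between u w. g (vec.dim c - vec.dim u))
      = (\<Sum>c\<in>subspaces_between u w. g (m - (vec.dim (perp c) - vec.dim (perp w))))"
  proof (intro sum.cong refl)
    fix c assume c: "c \<in> subspaces_between u w"
    have "m - (vec.dim (perp c) - vec.dim (perp w)) = vec.dim c - vec.dim u"
      using dim_perp[OF dim_c(1)[OF c]] dim_perp[OF w] dim_c(2,3)[OF c] unfolding m_def by arith
    then show "g (vec.dim c - vec.dim u) = g (m - (vec.dim (perp c) - vec.dim (perp w)))"
      by simp
  qed
  also have "\<dots> = (\<Sum>d\<in>subspaces_between (perp w) (perp u). g (m - (vec.dim d - vec.dim (perp w))))"
    by (rule sum.reindex_bij_betw[OF bij_betw_perp_subspaces_between[OF u w]])
  also have "\<dots> = (\<Sum>c\<in>subspaces_between u w. g (m - (vec.dim c - vec.dim u)))"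
  proof (rule sum_subspaces_between_shift)
    show "vec.dim (perp u) - vec.dim (perp w) = vec.dim w - vec.dim u"
      using dim_perp[OF u] dim_perp[OF w] by linarith
  qed (simp_all add: subspace_perp perp_antimono u w \<open>u \<subseteq> w\<close>)
  also have "\<dots> = (\<Sum>c\<in>subspaces_between u w. g (vec.dim w - vec.dim c))"
  proof (intro sum.cong refl)
    fix c assume "c \<in> subspaces_between u w"
    then have "m - (vec.dim c - vec.dim u) = vec.dim w - vec.dim c"
      using dim_c(2,3)[of c] unfolding m_def by arith
    then show "g (m - (vec.dim c - vec.dim u)) = g (vec.dim w - vec.dim c)"
      by simp
  qed
  finally show ?thesis .
qed

lemma sum_subspaces_between_signs_eq_0:
  fixes u w :: "('a::field^'n) set"
  assumes u: "vec.subspace u" and w: "vec.subspace w" and "u \<subseteq> w"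
    and odd: "odd (vec.dim w - vec.dim u)"
  shows "(\<Sum>c\<in>subspaces_between u w. (-1::int) ^ vec.dim c) = 0"
proof -
  define S where "S = (\<Sum>c\<in>subspaces_between u w. (-1::int) ^ (vec.dim c - vec.dim u))"
  have dim_c: "vec.dim u \<le> vec.dim c" "vec.dim c \<le> vec.dim w" if "c \<in> subspaces_between u w" for c
    using that vec.dim_subset by (auto simp: subspaces_between_def)
  have "S = (\<Sum>c\<in>subspaces_between u w. (-1::int) ^ (vec.dim w - vec.dim c))"
    unfolding S_def by (rule sum_subspaces_between_reverse[OF u w \<open>u \<subseteq> w\<close>])
  also have "\<dots> = - S"
    unfolding S_def sum_negf[symmetric]
  proof (intro sum.cong refl)
    fix c assume "c \<in> subspaces_between u w"
    then have "(vec.dim w - vec.dim c) + (vec.dim c - vec.dim u) = vec.dim w - vec.dim u"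
      using dim_c[of c] by arith
    then have "odd ((vec.dim w - vec.dim c) + (vec.dim c - vec.dim u))"
      using odd by simp
    then show "(-1::int) ^ (vec.dim w - vec.dim c) = - ((-1) ^ (vec.dim c - vec.dim u))"
      by (auto simp: minus_one_power_iff)
  qed
  finally have "S = 0"
    by simp
  moreover have "(\<Sum>c\<in>subspaces_between u w. (-1::int) ^ vec.dim c) = (-1) ^ vec.dim u * S"
    unfolding S_def sum_distrib_left
    using dim_c(1) by (intro sum.cong refl) (simp flip: power_add)
  ultimately show ?thesis
    by simp
qed


theorem proposition6p15:
  "Mpoly (subspace_lattice :: ('a::{field,finite} ^ 'n) set set) (\<subseteq>) vec.dim (-1 :: int) = 0"
proof (rule Mpoly_minus_one_eq_0)
  show "{0} \<in> subspace_lattice" "UNIV \<in> subspace_lattice"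
    by (simp_all add: subspace_lattice_def vec.subspace_single_0)
  show "{0} \<subseteq> c \<and> c \<subseteq> UNIV" if "c \<in> subspace_lattice" for c
    using that by (simp add: subspace_lattice_def vec.subspace_0)
  show "{0} \<noteq> (UNIV :: ('a^'n) set)"
    using vec_dim_card[where 'a = 'a and 'n = 'n]
    by (metis vec.dim_singleton zero_less_card_finite less_irrefl)
  fix u w :: "('a^'n) set"
  assume u: "u \<in> subspace_lattice" and w: "w \<in> subspace_lattice" and "u \<subseteq> w"
    and odd: "odd (vec.dim u + vec.dim w)"
  have "subspace_lattice \<inter> {u..w} = subspaces_between u w"
    by (auto simp: subspace_lattice_def subspaces_between_def)
  moreover have "odd (vec.dim w - vec.dim u)"
    using odd vec.dim_subset[OF \<open>u \<subseteq> w\<close>] by (simp add: even_diff_nat add.commute)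
  ultimately show "(\<Sum>c\<in>subspace_lattice \<inter> {u..w}. (-1::int) ^ vec.dim c) = 0"
    using sum_subspaces_between_signs_eq_0 u w \<open>u \<subseteq> w\<close> by (simp add: subspace_lattice_def)
qed

end
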